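(* Let $(X,d,p)$ be a pointed metric space and let $E=S_p(X)=\{d(x,p):x\in X\}$. The family $\mathbf{\Omega}_p^X(n)$ of all pretangent spaces to $X$ at $p$ with normal scaling sequences is uniformly bounded if and only if $E$ is completely strongly porous at $0$ (i.e. $E\in \mathbf{CSP}$). If $\mathbf{\Omega}_p^X(n)$ is uniformly bounded and $p$ is an accumulation point of $X$, then $$R^{*}(\mathbf{\Omega}_p^X(n))=M(\tilde L),$$ where $\tilde L=\{(l_n,m_n)\}_{n\in\mathbb N}$ is a universal element of $\tilde I_E^d$ and $M(\tilde L)=\limsup_{n\to\infty}\frac{l_n}{m_{n+1}}$.
   Context: Pretangent spaces. Let $(X,d,p)$ be a pointed metric space (marked point $p\in X$). A scaling sequence is a sequence $\tilde r=(r_n)_{n\in\mathbb N}$ of positive reals tending to $0$. $\tilde X$ is the set of all sequences of points of $X$. Two sequences $\tilde x=(x_n),\tilde y=(y_n)\in\tilde X$ are mutually stable w.r.t. $\tilde r$ if the finite limit $\tilde d_{\tilde r}(\tilde x,\tilde y):=\lim_{n\to\infty} d(x_n,y_n)/r_n$ exists. A family $\tilde F\subseteq\tilde X$ is self-stable if any two of its elements are mutually stable, and maximal self-stable if moreover every $\tilde z\in\tilde X\setminus \tilde F$ fails to be mutually stable with some element of $\tilde F$. Let $\tilde X_{p,\tilde r}$ denote a maximal self-stable family containing the constant sequence $\tilde p=(p,p,\dots)$ (such families exist, not necessarily unique). The pretangent space $\Omega_{p,\tilde r}^X$ is the metric identification of the pseudometric space $(\tilde X_{p,\tilde r},\tilde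 d_{\tilde r})$: its points are classes of $\tilde x\sim\tilde y\Leftrightarrow \tilde d_{\tilde r}(\tilde x,\tilde y)=0$, with metric $\rho(\gamma,\beta)=\tilde d_{\tilde r}(\tilde x,\tilde y)$ for $\tilde x\in\gamma$, $\tilde y\in\beta$. Its marked point is the class $\alpha$ of $\tilde p$. A sequence $(\tau_n)$ of reals is eventually decreasing if $\tau_{n+1}\le\tau_n$ for all sufficiently large $n$. A scaling sequence $(r_n)$ is normal (for $(X,d,p)$) if it is eventually decreasing and there is $(x_n)\in\tilde X$ with $\lim_{n\to\infty} d(x_n,p)/r_n=1$. $\mathbf{\Omega}_p^X(n)$ is the set of all pretangent spaces $\Omega_{p,\tilde r}^X$ to $X$ at $p$ with normal $\tilde r$ (it is empty if $p$ is isolated in $X$). Uniform boundedness. A family $\mathfrak F=\{(X_i,d_i,p_i):i\in I\}$ of pointed metric spaces is uniformly bounded if there is $c>0$ with $\operatorname{diam}X_i<c$ for all $i\in I$ (an empty family is uniformly bounded). Put $\rho^*(X_i)=\sup_{x\in X_i}d_i(x,p_i)$ and $R^*(\mathfrak F)=\sup_{i\in I}\rho^*(X_i)$. Porosity. Let $\mathbb R^+=[0,\infty)$ and $E\subseteq\mathbb R^+$. $\tilde E_0^d$ is the set of eventually decreasing sequences $\tilde\tau=(\tau_n)$ with $\tau_n\in E\setminus\{0\}$ for all $n$ and $\lim\tau_n=0$. $\tilde I_E^d$ is the set of sequences $\{(a_n,b_n)\}_{n\in\mathbb N}$ of open intervals in $\mathbb R^+$ such that each $(a_n,b_n)$ is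 a connected component of $\operatorname{Int}(\mathbb R^+\setminus E)$, $(a_n)$ is eventually decreasing, $\lim a_n=0$ and $\lim (b_n-a_n)/b_n=1$. For sequences of strictly positive numbers, $\tilde a\asymp\tilde\gamma$ means there are $c_1,c_2>0$ with $c_1a_n<\gamma_n<c_2a_n$ for all $n$. For $\tilde\tau\in\tilde E_0^d$, $E$ is $\tilde\tau$-strongly porous at $0$ if there is $\{(a_n,b_n)\}\in\tilde I_E^d$ with $\tilde\tau\asymp(a_n)_{n\in\mathbb N}$. $E$ is completely strongly porous at $0$, written $E\in\mathbf{CSP}$, if $E$ is $\tilde\tau$-strongly porous at $0$ for every $\tilde\tau\in\tilde E_0^d$. Universal elements. For $\tilde A=\{(a_n,b_n)\}$ and $\tilde L=\{(l_n,m_n)\}$ in $\tilde I_E^d$, write $\tilde A\preceq\tilde L$ if there are $N_1\in\mathbb N$ and $f:\{N_1,N_1+1,\dots\}\to\mathbb N$ with $a_n=l_{f(n)}$ for every $n\ge N_1$. $\tilde L\in\tilde I_E^d$ is universal if $\tilde B\preceq\tilde L$ for every $\tilde B\in\tilde I_E^d$. It is known that if $E\in\mathbf{CSP}$ and $0$ is an accumulation point of $E$, a universal $\tilde L$ exists, and that $M(\tilde L)$ depends only on $E$. *)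

theory Defs
  imports "HOL-Analysis.Analysis"
begin

section \<open>Pointed metric spaces as objects\<close>

text \<open>
  The ambient space \<open>(X, d, p)\<close> is a type of class \<^class>\<open>metric_space\<close> together with a point.
  Pretangent spaces live on sets of equivalence classes, so they are represented by explicit
  carriers; only the values of \<open>pdist\<close> on the carrier are meaningful.
\<close>

record 'b pointed_space =
  points :: "'b set"
  pdist :: "'b \<Rightarrow> 'b \<Rightarrow> real"
  mark :: 'b

definition space_diam :: "'b pointed_space \<Rightarrow> ereal" where
  "space_diam X = (SUP (x, y) \<in> points X \<times> points X. ereal (pdist X x y))"

definition uniformly_bounded_family :: "'b pointed_space set \<Rightarrow> bool" where
  "uniformly_bounded_family \<F> \<longleftrightarrow> (\<exists>c::real. c > 0 \<and> (\<forall>X\<in>\<F>. space_diam X < ereal c))"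

definition rho_star :: "'b pointed_space \<Rightarrow> ereal" where
  "rho_star X = (SUP x \<in> points X. ereal (pdist X x (mark X)))"

definition R_star :: "'b pointed_space set \<Rightarrow> ereal" where
  "R_star \<F> = (SUP X \<in> \<F>. rho_star X)"


section \<open>Pretangent spaces\<close>

definition scaling_sequence :: "(nat \<Rightarrow> real) \<Rightarrow> bool" where
  "scaling_sequence r \<longleftrightarrow> (\<forall>n. r n > 0) \<and> r \<longlonglongrightarrow> 0"

definition mutually_stable ::
    "(nat \<Rightarrow> real) \<Rightarrow> (nat \<Rightarrow> 'a::metric_space) \<Rightarrow> (nat \<Rightarrow> 'a) \<Rightarrow> bool" where
  "mutually_stable r x y \<longleftrightarrow> convergent (\<lambda>n. dist (x n) (y n) / r n)"

definition seq_dist ::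
    "(nat \<Rightarrow> real) \<Rightarrow> (nat \<Rightarrow> 'a::metric_space) \<Rightarrow> (nat \<Rightarrow> 'a) \<Rightarrow> real" where
  "seq_dist r x y = lim (\<lambda>n. dist (x n) (y n) / r n)"

definition self_stable :: "(nat \<Rightarrow> real) \<Rightarrow> (nat \<Rightarrow> 'a::metric_space) set \<Rightarrow> bool" where
  "self_stable r F \<longleftrightarrow> (\<forall>x\<in>F. \<forall>y\<in>F. mutually_stable r x y)"

definition maximal_self_stable :: "(nat \<Rightarrow> real) \<Rightarrow> (nat \<Rightarrow> 'a::metric_space) set \<Rightarrow> bool" where
  "maximal_self_stable r F \<longleftrightarrow>
     self_stable r F \<and> (\<forall>z. z \<notin> F \<longrightarrow> (\<exists>x\<in>F. \<not> mutually_stable r z x))"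

definition zero_dist_rel ::
    "(nat \<Rightarrow> real) \<Rightarrow> (nat \<Rightarrow> 'a::metric_space) set \<Rightarrow> ((nat \<Rightarrow> 'a) \<times> (nat \<Rightarrow> 'a)) set" where
  "zero_dist_rel r F = {(x, y). x \<in> F \<and> y \<in> F \<and> seq_dist r x y = 0}"

text \<open>
  The distance of two classes is computed on chosen representatives; it does not depend on the
  choice, see \<open>pdist_pretangent_space\<close> below.
\<close>

definition pretangent_space ::
    "'a::metric_space \<Rightarrow> (nat \<Rightarrow> real) \<Rightarrow> (nat \<Rightarrow> 'a) set \<Rightarrow> (nat \<Rightarrow> 'a) set pointed_space" where
  "pretangent_space p r F =
     \<lparr>points = F // zero_dist_rel r F,
      pdist = (\<lambda>\<gamma> \<beta>. seq_dist r (SOME x. x \<in> \<gamma>) (SOME y. y \<in> \<beta>)),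
      mark = zero_dist_rel r F `` {\<lambda>_. p}\<rparr>"

text \<open>All pretangent spaces at \<open>p\<close> for the scaling sequence \<open>r\<close>: one for each admissible
  maximal family.\<close>

definition pretangent_spaces ::
    "'a::metric_space \<Rightarrow> (nat \<Rightarrow> real) \<Rightarrow> (nat \<Rightarrow> 'a) set pointed_space set" where
  "pretangent_spaces p r =
     {pretangent_space p r F | F. maximal_self_stable r F \<and> (\<lambda>_. p) \<in> F}"

definition eventually_decreasing :: "(nat \<Rightarrow> real) \<Rightarrow> bool" where
  "eventually_decreasing \<tau> \<longleftrightarrow> (\<forall>\<^sub>F n in sequentially. \<tau> (Suc n) \<le> \<tau> n)"

definition normal_scaling :: "'a::metric_space \<Rightarrow> (nat \<Rightarrow> real) \<Rightarrow> bool" where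
  "normal_scaling p r \<longleftrightarrow>
     scaling_sequence r \<and> eventually_decreasing r \<and>
     (\<exists>x :: nat \<Rightarrow> 'a. (\<lambda>n. dist (x n) p / r n) \<longlonglongrightarrow> 1)"

definition normal_pretangent_spaces ::
    "'a::metric_space \<Rightarrow> (nat \<Rightarrow> 'a) set pointed_space set" where
  "normal_pretangent_spaces p = (\<Union>r \<in> {r. normal_scaling p r}. pretangent_spaces p r)"


subsection \<open>Pretangent spaces are well-defined metric spaces\<close>

lemma seq_dist_tendsto:
  assumes "self_stable r F" "x \<in> F" "y \<in> F"
  shows "(\<lambda>n. dist (x n) (y n) / r n) \<longlonglongrightarrow> seq_dist r x y"
  using assms by (auto simp: self_stable_def mutually_stable_def seq_dist_def convergent_LIMSEQ_iff)

lemma seq_dist_refl [simp]: "seq_dist r x x = 0"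
  by (simp add: seq_dist_def)

lemma seq_dist_commute: "seq_dist r x y = seq_dist r y x"
  by (simp add: seq_dist_def dist_commute)

lemma seq_dist_nonneg:
  assumes "scaling_sequence r" "self_stable r F" "x \<in> F" "y \<in> F"
  shows "0 \<le> seq_dist r x y"
proof (rule LIMSEQ_le_const[OF seq_dist_tendsto[OF assms(2-4)]])
  show "\<exists>N. \<forall>n\<ge>N. 0 \<le> dist (x n) (y n) / r n"
    using assms(1) by (auto simp: scaling_sequence_def less_imp_le)
qed

lemma seq_dist_triangle:
  assumes "scaling_sequence r" "self_stable r F" "x \<in> F" "y \<in> F" "z \<in> F"
  shows "seq_dist r x z \<le> seq_dist r x y + seq_dist r y z"
proof (rule LIMSEQ_le[OF seq_dist_tendsto[OF assms(2,3,5)]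
      tendsto_add[OF seq_dist_tendsto[OF assms(2,3,4)] seq_dist_tendsto[OF assms(2,4,5)]]])
  have "dist (x n) (z n) / r n \<le> dist (x n) (y n) / r n + dist (y n) (z n) / r n" for n
  proof -
    have "0 < r n" using assms(1) by (simp add: scaling_sequence_def)
    then show ?thesis
      using divide_right_mono[OF dist_triangle[of "x n" "z n" "y n"], of "r n"]
      by (simp add: add_divide_distrib)
  qed
  then show "\<exists>N. \<forall>n\<ge>N. dist (x n) (z n) / r n \<le> dist (x n) (y n) / r n + dist (y n) (z n) / r n"
    by blast
qed

lemma equiv_zero_dist_rel:
  assumes "scaling_sequence r" "self_stable r F"
  shows "equiv F (zero_dist_rel r F)"
proof (rule equivI)
  show "zero_dist_rel r F \<subseteq> F \<times> F" by (auto simp: zero_dist_rel_def)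
  show "refl_on F (zero_dist_rel r F)" by (auto simp: zero_dist_rel_def refl_on_def)
  show "sym (zero_dist_rel r F)"
    by (auto simp: zero_dist_rel_def sym_def seq_dist_commute)
  show "trans (zero_dist_rel r F)"
  proof (rule transI)
    fix x y z
    assume "(x, y) \<in> zero_dist_rel r F" "(y, z) \<in> zero_dist_rel r F"
    then have *: "x \<in> F" "y \<in> F" "z \<in> F" "seq_dist r x y = 0" "seq_dist r y z = 0"
      by (auto simp: zero_dist_rel_def)
    then show "(x, z) \<in> zero_dist_rel r F"
      using seq_dist_triangle[OF assms *(1-3)] seq_dist_nonneg[OF assms *(1,3)]
      by (simp add: zero_dist_rel_def)
  qed
qed

lemma pdist_pretangent_space:
  assumes "scaling_sequence r" "self_stable r F"
    and \<gamma>: "\<gamma> \<in> points (pretangent_space p r F)" "x \<in> \<gamma>"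
    and \<beta>: "\<beta> \<in> points (pretangent_space p r F)" "y \<in> \<beta>"
  shows "pdist (pretangent_space p r F) \<gamma> \<beta> = seq_dist r x y"
proof -
  define x' where "x' = (SOME x. x \<in> \<gamma>)"
  define y' where "y' = (SOME y. y \<in> \<beta>)"
  have mem: "x' \<in> \<gamma>" "y' \<in> \<beta>"
    using someI[of "\<lambda>x. x \<in> \<gamma>", OF \<gamma>(2)] someI[of "\<lambda>y. y \<in> \<beta>", OF \<beta>(2)]
    by (simp_all add: x'_def y'_def)
  note eq = equiv_zero_dist_rel[OF assms(1,2)]
  have "(x, x') \<in> zero_dist_rel r F" "(y, y') \<in> zero_dist_rel r F"
    using \<gamma> \<beta> mem quotient_eq_iff[OF eq] by (auto simp: pretangent_space_def)
  then have F: "x \<in> F" "x' \<in> F" "y \<in> F" "y' \<in> F"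
    and 0: "seq_dist r x x' = 0" "seq_dist r y y' = 0"
    by (auto simp: zero_dist_rel_def)
  note tri = seq_dist_triangle[OF assms(1,2)]
  have "seq_dist r x' y' \<le> seq_dist r x y"
    using tri[OF F(2,1,4)] tri[OF F(1,3,4)] 0 by (simp add: seq_dist_commute)
  moreover have "seq_dist r x y \<le> seq_dist r x' y'"
    using tri[OF F(1,2,3)] tri[OF F(2,4,3)] 0 by (simp add: seq_dist_commute)
  ultimately show ?thesis
    by (simp add: pretangent_space_def x'_def y'_def)
qed

lemma Metric_space_pretangent_space:
  fixes p :: "'a::metric_space"
  assumes "scaling_sequence r" "self_stable r F"
  defines "\<Omega> \<equiv> pretangent_space p r F"
  shows "Metric_space (points \<Omega>) (\<lambda>\<gamma> \<beta>. if \<gamma> \<in> points \<Omega> \<and> \<beta> \<in> points \<Omega> then pdist \<Omega> \<gamma> \<beta> else 0)"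
proof -
  note eq = equiv_zero_dist_rel[OF assms(1,2)]
  note pd = pdist_pretangent_space[OF assms(1,2), of _ p, folded \<Omega>_def]
  have rep: "\<exists>x. x \<in> \<gamma> \<and> x \<in> F" if "\<gamma> \<in> points \<Omega>" for \<gamma>
    using that in_quotient_imp_non_empty[OF eq] in_quotient_imp_subset[OF eq]
    by (fastforce simp: \<Omega>_def pretangent_space_def)
  have nonneg: "0 \<le> pdist \<Omega> \<gamma> \<beta>" if "\<gamma> \<in> points \<Omega>" "\<beta> \<in> points \<Omega>" for \<gamma> \<beta>
    using rep[OF that(1)] rep[OF that(2)] pd that seq_dist_nonneg[OF assms(1,2)] by metis
  have comm: "pdist \<Omega> \<gamma> \<beta> = pdist \<Omega> \<beta> \<gamma>" for \<gamma> \<beta>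
    by (simp add: \<Omega>_def pretangent_space_def seq_dist_commute)
  have zero: "pdist \<Omega> \<gamma> \<beta> = 0 \<longleftrightarrow> \<gamma> = \<beta>" if \<gamma>\<beta>: "\<gamma> \<in> points \<Omega>" "\<beta> \<in> points \<Omega>" for \<gamma> \<beta>
  proof -
    obtain x y where xy: "x \<in> \<gamma>" "x \<in> F" "y \<in> \<beta>" "y \<in> F"
      using rep[OF \<gamma>\<beta>(1)] rep[OF \<gamma>\<beta>(2)] by blast
    have "\<gamma> = \<beta> \<longleftrightarrow> (x, y) \<in> zero_dist_rel r F"
      using quotient_eq_iff[OF eq _ _ xy(1,3)] \<gamma>\<beta> by (simp add: \<Omega>_def pretangent_space_def)
    then show ?thesis
      using pd[OF \<gamma>\<beta>(1) xy(1) \<gamma>\<beta>(2) xy(3)] xy by (simp add: zero_dist_rel_def)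
  qed
  have tri: "pdist \<Omega> \<gamma> \<delta> \<le> pdist \<Omega> \<gamma> \<beta> + pdist \<Omega> \<beta> \<delta>"
    if mem: "\<gamma> \<in> points \<Omega>" "\<beta> \<in> points \<Omega>" "\<delta> \<in> points \<Omega>" for \<gamma> \<beta> \<delta>
  proof -
    obtain x y z where "x \<in> \<gamma>" "x \<in> F" "y \<in> \<beta>" "y \<in> F" "z \<in> \<delta>" "z \<in> F"
      using rep[OF mem(1)] rep[OF mem(2)] rep[OF mem(3)] by blast
    then show ?thesis
      using pd mem seq_dist_triangle[OF assms(1,2), of x y z] by simp
  qed
  show ?thesis
    by unfold_locales (auto simp: nonneg zero tri intro: comm)
qed

lemma mark_in_pretangent_space:
  assumes "(\<lambda>_. p) \<in> F"
  shows "mark (pretangent_space p r F) \<in> points (pretangent_space p r F)"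
  using assms by (simp add: pretangent_space_def quotientI)


section \<open>Porosity at zero\<close>

definition distance_set :: "'a::metric_space \<Rightarrow> real set" where
  "distance_set p = range (\<lambda>x. dist x p)"

definition decreasing_seqs :: "real set \<Rightarrow> (nat \<Rightarrow> real) set" where
  "decreasing_seqs E =
     {\<tau>. eventually_decreasing \<tau> \<and> (\<forall>n. \<tau> n \<in> E - {0}) \<and> \<tau> \<longlonglongrightarrow> 0}"

text \<open>
  An interval \<open>(a, b)\<close> is represented by the pair of its end points. Elements of
  \<^const>\<open>components\<close> are nonempty subsets of \<open>{0..}\<close> here, which forces \<open>0 \<le> a < b\<close>. The interior is
  taken in \<open>\<real>\<close>; it agrees with the interior in \<open>{0..}\<close> whenever \<open>0 \<in> E\<close>, in particular for
  \<^const>\<open>distance_set\<close>.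
\<close>

definition gap_seqs :: "real set \<Rightarrow> (nat \<Rightarrow> real \<times> real) set" where
  "gap_seqs E =
     {A. (\<forall>n. {fst (A n)<..<snd (A n)} \<in> components (interior ({0..} - E))) \<and>
         eventually_decreasing (\<lambda>n. fst (A n)) \<and>
         (\<lambda>n. fst (A n)) \<longlonglongrightarrow> 0 \<and>
         (\<lambda>n. (snd (A n) - fst (A n)) / snd (A n)) \<longlonglongrightarrow> 1}"

definition asymp_comparable :: "(nat \<Rightarrow> real) \<Rightarrow> (nat \<Rightarrow> real) \<Rightarrow> bool" where
  "asymp_comparable a g \<longleftrightarrow>
     (\<exists>c1 > 0. \<exists>c2 > 0. \<forall>n. c1 * a n < g n \<and> g n < c2 * a n)"

definition strongly_porous_along :: "(nat \<Rightarrow> real) \<Rightarrow> real set \<Rightarrow> bool" where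
  "strongly_porous_along \<tau> E \<longleftrightarrow>
     (\<exists>A \<in> gap_seqs E. asymp_comparable \<tau> (\<lambda>n. fst (A n)))"

definition CSP :: "real set set" where
  "CSP = {E. E \<subseteq> {0..} \<and> (\<forall>\<tau> \<in> decreasing_seqs E. strongly_porous_along \<tau> E)}"

definition gap_preceq :: "(nat \<Rightarrow> real \<times> real) \<Rightarrow> (nat \<Rightarrow> real \<times> real) \<Rightarrow> bool" where
  "gap_preceq A L \<longleftrightarrow> (\<exists>N. \<exists>f :: nat \<Rightarrow> nat. \<forall>n\<ge>N. fst (A n) = fst (L (f n)))"

definition universal_gap_seq :: "real set \<Rightarrow> (nat \<Rightarrow> real \<times> real) \<Rightarrow> bool" where
  "universal_gap_seq E L \<longleftrightarrow> L \<in> gap_seqs E \<and> (\<forall>B \<in> gap_seqs E. gap_preceq B L)"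

definition gap_M :: "(nat \<Rightarrow> real \<times> real) \<Rightarrow> ereal" where
  "gap_M L = limsup (\<lambda>n. ereal (fst (L n) / snd (L (Suc n))))"

end

theory Submission
  imports Defs
begin

text \<open>
  Everything is reduced to one property of \<open>E = distance_set p\<close>. Say that \<open>E\<close> has comparable
  pairs for \<open>K\<close> and \<open>D\<close> if arbitrarily close to \<open>0\<close> there are \<open>t, e \<in> E\<close> with \<open>t > 0\<close> and
  \<open>K \<le> e / t \<le> D\<close>. The upper bound \<open>D\<close> is arbitrary but fixed, so that compactness applies:
  along a subsequence \<open>e / t\<close> converges to a finite limit \<open>s \<ge> K\<close>, and with the numbers \<open>t\<close> as
  a normal scaling sequence some pretangent space has a point at distance \<open>s\<close> from its mark.
  Conversely a point at distance more than \<open>K\<close> from the mark gives such pairs. Hence \<open>R\<^sup>*\<close> is the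
  supremum of all \<open>K\<close> for which \<open>E\<close> has comparable pairs for some \<open>D\<close>
  (\<open>comparable_pairs_if_less_R_star\<close>, \<open>R_star_ge_if_comparable_pairs\<close>), and uniform boundedness
  means that for some \<open>K\<close> there are no comparable pairs, whatever \<open>D\<close> is.

  If \<open>K\<close> is of this kind and \<open>\<tau>\<close> is a decreasing sequence in \<open>E\<close>, then \<open>E\<close> misses
  \<open>[K \<tau> n, D \<tau> n]\<close> for every \<open>D\<close> and all large \<open>n\<close>, so the gap of \<open>E\<close> around \<open>K \<tau> n\<close> starts in
  \<open>[\<tau> n, K \<tau> n]\<close> and is relatively longer and longer (\<open>gap_seq_along\<close>); this is strong porosity
  along \<open>\<tau>\<close>. If no \<open>K\<close> is of this kind, a single sequence \<open>\<tau>\<close> that uses the pairs for every \<open>K\<close>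
  infinitely often defeats strong porosity: the gap next to \<open>\<tau> n\<close> must start below \<open>c \<tau> n\<close> for a
  fixed \<open>c\<close>, and for \<open>K > c\<close> the partner of \<open>\<tau> n\<close> stops it at bounded relative length
  (\<open>no_comparable_pairs_if_CSP\<close>).

  For a universal sequence \<open>(l n, m n)\<close> of gaps, a comparable pair close to \<open>0\<close> cannot straddle
  one of the long gaps, so it lies in a block \<open>[m (i + 1), l i]\<close>, whence \<open>K \<le> l i / m (i + 1)\<close>.
  Conversely, blocks with \<open>l i / m (i + 1) > K\<close> yield comparable pairs, since otherwise
  \<open>gap_seq_along\<close> would produce long gaps inside the blocks, and these would be missing in the
  universal sequence.
\<close>

section \<open>Comparable pairs\<close>

definition comparable_pairs :: "real set \<Rightarrow> real \<Rightarrow> real \<Rightarrow> bool" where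
  "comparable_pairs E K D \<longleftrightarrow>
     (\<forall>\<epsilon>>0. \<exists>t\<in>E. \<exists>e\<in>E. 0 < t \<and> t < \<epsilon> \<and> K * t \<le> e \<and> e \<le> D * t)"

lemma comparable_pairs_mono:
  assumes "comparable_pairs E K D" "K' \<le> K" "D \<le> D'"
  shows "comparable_pairs E K' D'"
  unfolding comparable_pairs_def
proof (intro allI impI)
  fix \<epsilon> :: real assume "\<epsilon> > 0"
  then obtain t e where te: "t \<in> E" "e \<in> E" "0 < t" "t < \<epsilon>" "K * t \<le> e" "e \<le> D * t"
    using assms(1) unfolding comparable_pairs_def by blast
  have "K' * t \<le> K * t" "D * t \<le> D' * t"
    using assms te(3) by (simp_all add: mult_right_mono)
  with te show "\<exists>t\<in>E. \<exists>e\<in>E. 0 < t \<and> t < \<epsilon> \<and> K' * t \<le> e \<and> e \<le> D' * t"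
    by - (rule bexI[of _ t], rule bexI[of _ e], linarith+)
qed

text \<open>
  A property that holds for arbitrarily small \<open>t\<close> can be realised along a decreasing null
  sequence. The property may depend on the index, and each \<open>t n\<close> comes with a witness \<open>w n\<close>.
\<close>

lemma decreasing_null_choice:
  fixes P :: "nat \<Rightarrow> real \<Rightarrow> 'b \<Rightarrow> bool"
  assumes "\<And>n \<epsilon>. \<epsilon> > 0 \<Longrightarrow> \<exists>t w. 0 < t \<and> t < \<epsilon> \<and> P n t w"
  obtains t w where "\<And>n. 0 < t n" "\<And>n. P n (t n) (w n)" "decseq t" "t \<longlonglongrightarrow> 0"
proof -
  define Q where "Q n z \<longleftrightarrow> 0 < fst z \<and> fst z < 1 / real (Suc n) \<and> P n (fst z) (snd z)" for n z
  have "\<exists>f. \<forall>n. Q n (f n) \<and> fst (f (Suc n)) < fst (f n)"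
  proof (rule dependent_nat_choice)
    obtain t w where "0 < t" "t < 1" "P 0 t w"
      using assms[of 1 0] by auto
    then show "\<exists>z. Q 0 z" by (intro exI[of _ "(t, w)"]) (simp add: Q_def)
  next
    fix z n assume "Q n z"
    then have "min (fst z) (1 / real (Suc (Suc n))) > 0" by (simp add: Q_def)
    from assms[OF this, of "Suc n"] obtain t w where "0 < t"
      "t < min (fst z) (1 / real (Suc (Suc n)))" "P (Suc n) t w" by blast
    then show "\<exists>y. Q (Suc n) y \<and> fst y < fst z"
      by (intro exI[of _ "(t, w)"]) (simp add: Q_def)
  qed
  then obtain f where f: "\<And>n. Q n (f n)" "\<And>n. fst (f (Suc n)) < fst (f n)" by blast
  show ?thesis
  proof (rule that[of "\<lambda>n. fst (f n)" "\<lambda>n. snd (f n)"])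
    show "decseq (\<lambda>n. fst (f n))" using f(2) by (simp add: decseq_Suc_iff less_imp_le)
    show "(\<lambda>n. fst (f n)) \<longlonglongrightarrow> 0"
      by (rule tendsto_sandwich[OF _ _ tendsto_const LIMSEQ_inverse_real_of_nat])
         (use f(1) in \<open>auto simp: Q_def inverse_eq_divide less_imp_le intro!: always_eventually\<close>)
  qed (use f(1) in \<open>auto simp: Q_def\<close>)
qed

lemma decreasing_seqsI:
  assumes "decseq t" "t \<longlonglongrightarrow> 0" "\<And>n. t n \<in> E" "\<And>n. 0 < t n"
  shows "t \<in> decreasing_seqs E"
  using assms by (auto simp: decreasing_seqs_def eventually_decreasing_def decseq_Suc_iff
      less_imp_neq[THEN not_sym])

lemma decreasing_seqs_pos:
  assumes "\<tau> \<in> decreasing_seqs E" "E \<subseteq> {0..}"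
  shows "0 < \<tau> n"
proof -
  have "\<tau> n \<in> E" "\<tau> n \<noteq> 0" using assms(1) by (simp_all add: decreasing_seqs_def)
  with assms(2) show ?thesis by (auto simp: less_le)
qed

lemma zero_in_distance_set [simp]: "0 \<in> distance_set p"
  by (auto simp: distance_set_def intro: rev_image_eqI)

lemma distance_set_nonneg: "distance_set p \<subseteq> {0..}"
  by (auto simp: distance_set_def)

lemma small_distances:
  fixes p :: "'a::metric_space"
  assumes "p islimpt (UNIV :: 'a set)" "\<epsilon> > 0"
  shows "\<exists>t\<in>distance_set p. 0 < t \<and> t < \<epsilon>"
  using assms by (force simp: islimpt_approachable distance_set_def)

section \<open>Pretangent spaces and comparable pairs\<close>

lemma self_stable_subset_maximal:
  assumes "self_stable r F"
  obtains M where "F \<subseteq> M" "maximal_self_stable r M"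
proof -
  have "\<exists>M\<in>{G. F \<subseteq> G \<and> self_stable r G}. \<forall>X\<in>{G. F \<subseteq> G \<and> self_stable r G}. M \<subseteq> X \<longrightarrow> X = M"
  proof (rule subset_Zorn_nonempty)
    fix C assume C: "C \<noteq> {}" "subset.chain {G. F \<subseteq> G \<and> self_stable r G} C"
    have "self_stable r (\<Union>C)"
      unfolding self_stable_def
    proof (intro ballI)
      fix x y assume "x \<in> \<Union>C" "y \<in> \<Union>C"
      then obtain G1 G2 where G: "G1 \<in> C" "x \<in> G1" "G2 \<in> C" "y \<in> G2" by blast
      moreover have "G1 \<subseteq> G2 \<or> G2 \<subseteq> G1"
        using C(2) G(1,3) by (simp add: subset_chain_def)
      ultimately obtain G where "G \<in> C" "x \<in> G" "y \<in> G" by blast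
      then show "mutually_stable r x y"
        using C(2) by (auto simp: subset_chain_def self_stable_def)
    qed
    moreover have "F \<subseteq> \<Union>C"
      using C by (force simp: subset_chain_def)
    ultimately show "\<Union>C \<in> {G. F \<subseteq> G \<and> self_stable r G}" by blast
  next
    show "{G. F \<subseteq> G \<and> self_stable r G} \<noteq> {}" using assms by blast
  qed
  then obtain M where M: "F \<subseteq> M" "self_stable r M"
    and M_max: "\<forall>X\<in>{G. F \<subseteq> G \<and> self_stable r G}. M \<subseteq> X \<longrightarrow> X = M" by auto
  have "\<exists>x\<in>M. \<not> mutually_stable r z x" if "z \<notin> M" for z
  proof (rule ccontr)
    assume "\<not> ?thesis"
    then have "self_stable r (insert z M)"
      using M(2) by (auto simp: self_stable_def mutually_stable_def dist_commute convergent_const)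
    then have "insert z M = M" using M(1) by (intro M_max[rule_format]) auto
    then show False using that by blast
  qed
  with M that show ?thesis by (auto simp: maximal_self_stable_def)
qed

lemma normal_pretangent_spaceE:
  assumes "X \<in> normal_pretangent_spaces p"
  obtains r F where "normal_scaling p r" "scaling_sequence r" "self_stable r F" "(\<lambda>_. p) \<in> F"
    "X = pretangent_space p r F"
  using assms by (auto simp: normal_pretangent_spaces_def pretangent_spaces_def
      maximal_self_stable_def normal_scaling_def)

lemma pretangent_space_metric:
  assumes "X \<in> normal_pretangent_spaces p"
  shows "mark X \<in> points X"
    and "\<lbrakk>\<gamma> \<in> points X; \<beta> \<in> points X\<rbrakk> \<Longrightarrow> pdist X \<gamma> \<beta> \<le> pdist X \<gamma> (mark X) + pdist X \<beta> (mark X)"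
proof -
  obtain r F where rF: "scaling_sequence r" "self_stable r F" "(\<lambda>_. p) \<in> F"
    and X: "X = pretangent_space p r F" using assms by (rule normal_pretangent_spaceE)
  show m: "mark X \<in> points X" using mark_in_pretangent_space[OF rF(3)] X by simp
  interpret Metric_space "points X"
    "\<lambda>\<gamma> \<beta>. if \<gamma> \<in> points X \<and> \<beta> \<in> points X then pdist X \<gamma> \<beta> else 0"
    unfolding X by (rule Metric_space_pretangent_space[OF rF(1,2)])
  show "pdist X \<gamma> \<beta> \<le> pdist X \<gamma> (mark X) + pdist X \<beta> (mark X)"
    if "\<gamma> \<in> points X" "\<beta> \<in> points X"
    using triangle[of \<gamma> "mark X" \<beta>] commute[of "mark X" \<beta>] m that by simp
qed

lemma space_diam_le_twice:
  assumes X: "X \<in> normal_pretangent_spaces p" and "rho_star X \<le> ereal K"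
  shows "space_diam X \<le> ereal (2 * K)"
proof -
  have "pdist X \<gamma> (mark X) \<le> K" if "\<gamma> \<in> points X" for \<gamma>
  proof -
    have "ereal (pdist X \<gamma> (mark X)) \<le> rho_star X"
      unfolding rho_star_def using that by (rule SUP_upper)
    with assms(2) have "ereal (pdist X \<gamma> (mark X)) \<le> ereal K" by (rule order_trans[rotated])
    then show ?thesis by simp
  qed
  note mark = this
  have "pdist X \<gamma> \<beta> \<le> 2 * K" if "\<gamma> \<in> points X" "\<beta> \<in> points X" for \<gamma> \<beta>
    using pretangent_space_metric(2)[OF X that] mark[OF that(1)] mark[OF that(2)] by linarith
  then show ?thesis by (auto simp: space_diam_def intro!: SUP_least)
qed

lemma rho_star_le_space_diam:
  assumes "X \<in> normal_pretangent_spaces p"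
  shows "rho_star X \<le> space_diam X"
  unfolding rho_star_def
proof (rule SUP_least)
  fix x assume "x \<in> points X"
  then show "ereal (pdist X x (mark X)) \<le> space_diam X"
    unfolding space_diam_def using pretangent_space_metric(1)[OF assms]
    by (intro SUP_upper2[of "(x, mark X)"]) auto
qed

text \<open>
  Normality supplies distances asymptotic to \<open>r\<close>, so a point at distance \<open>s > K\<close> from the mark
  gives pairs of distances whose quotients tend to \<open>s\<close>.
\<close>

lemma comparable_pairs_if_less_rho_star:
  assumes X: "X \<in> normal_pretangent_spaces p" and K: "ereal K < rho_star X"
  shows "\<exists>D. comparable_pairs (distance_set p) K D"
proof -
  obtain r F where normal: "normal_scaling p r" and rF: "scaling_sequence r" "self_stable r F"
    and pF: "(\<lambda>_. p) \<in> F" and Xeq: "X = pretangent_space p r F"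
    using X by (rule normal_pretangent_spaceE)
  have r: "r n > 0" for n using rF(1) by (simp add: scaling_sequence_def)
  note eq = equiv_zero_dist_rel[OF rF]
  obtain \<gamma> where \<gamma>: "\<gamma> \<in> points X" "K < pdist X \<gamma> (mark X)"
    using K by (auto simp: rho_star_def less_SUP_iff)
  obtain x where x: "x \<in> \<gamma>" "x \<in> F"
    using \<gamma>(1) in_quotient_imp_non_empty[OF eq] in_quotient_imp_subset[OF eq]
    by (fastforce simp: Xeq pretangent_space_def)
  have "(\<lambda>_. p) \<in> mark X" using pF by (simp add: Xeq pretangent_space_def zero_dist_rel_def)
  then have "pdist X \<gamma> (mark X) = seq_dist r x (\<lambda>_. p)"
    using pdist_pretangent_space[OF rF, of \<gamma> p x "mark X"] \<gamma>(1) x(1)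
      pretangent_space_metric(1)[OF X] Xeq by simp
  then obtain s where s: "(\<lambda>n. dist (x n) p / r n) \<longlonglongrightarrow> s" "K < s"
    using seq_dist_tendsto[OF rF(2) x(2) pF] \<gamma>(2) by simp
  obtain y where y: "(\<lambda>n. dist (y n) p / r n) \<longlonglongrightarrow> 1"
    using normal by (auto simp: normal_scaling_def)
  have "(\<lambda>n. dist (y n) p / r n * r n) \<longlonglongrightarrow> 1 * 0"
    using y rF(1) by (intro tendsto_mult) (auto simp: scaling_sequence_def)
  then have y0: "(\<lambda>n. dist (y n) p) \<longlonglongrightarrow> 0"
    using r by (simp add: less_imp_neq[THEN not_sym])
  have "(\<lambda>n. (dist (x n) p / r n) / (dist (y n) p / r n)) \<longlonglongrightarrow> s / 1"
    using s(1) y by (rule tendsto_divide) simp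
  then have q: "(\<lambda>n. dist (x n) p / dist (y n) p) \<longlonglongrightarrow> s"
    using r by (simp add: less_imp_neq[THEN not_sym])
  have "comparable_pairs (distance_set p) K (s + 1)"
    unfolding comparable_pairs_def
  proof (intro allI impI)
    fix \<epsilon> :: real assume "\<epsilon> > 0"
    have "\<forall>\<^sub>F n in sequentially. 0 < dist (y n) p / r n \<and> dist (y n) p < \<epsilon> \<and>
        K < dist (x n) p / dist (y n) p \<and> dist (x n) p / dist (y n) p < s + 1"
      using order_tendstoD(1)[OF y, of 0] order_tendstoD(2)[OF y0 \<open>\<epsilon> > 0\<close>]
        order_tendstoD(1)[OF q s(2)] order_tendstoD(2)[OF q, of "s + 1"]
      by (simp add: eventually_conj_iff)
    then obtain n where n: "0 < dist (y n) p / r n" "dist (y n) p < \<epsilon>"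
      "K < dist (x n) p / dist (y n) p" "dist (x n) p / dist (y n) p < s + 1"
      by (auto dest: eventually_happens)
    have "0 < dist (y n) p" using n(1) r[of n] by (simp add: zero_less_divide_iff)
    with n show "\<exists>t\<in>distance_set p. \<exists>e\<in>distance_set p.
        0 < t \<and> t < \<epsilon> \<and> K * t \<le> e \<and> e \<le> (s + 1) * t"
      by (intro bexI[of _ "dist (y n) p"] bexI[of _ "dist (x n) p"])
         (auto simp: distance_set_def pos_less_divide_eq pos_divide_less_eq)
  qed
  then show ?thesis by blast
qed

lemma comparable_pairs_if_less_R_star:
  assumes "ereal K < R_star (normal_pretangent_spaces p)"
  shows "\<exists>D. comparable_pairs (distance_set p) K D"
  using assms by (auto simp: R_star_def less_SUP_iff dest: comparable_pairs_if_less_rho_star)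

lemma rho_star_ge:
  fixes p :: "'a::metric_space"
  assumes "normal_scaling p r" and x: "(\<lambda>n. dist (x n) p / r n) \<longlonglongrightarrow> s"
  shows "\<exists>X\<in>normal_pretangent_spaces p. ereal s \<le> rho_star X"
proof -
  have stab: "self_stable r {\<lambda>_. p, x}"
    using x by (auto simp: self_stable_def mutually_stable_def dist_commute convergent_def)
  obtain F where F: "{\<lambda>_. p, x} \<subseteq> F" "maximal_self_stable r F"
    using stab by (rule self_stable_subset_maximal)
  define X where "X = pretangent_space p r F"
  have r: "scaling_sequence r" using assms(1) by (simp add: normal_scaling_def)
  have ss: "self_stable r F" using F(2) by (simp add: maximal_self_stable_def)
  have X: "X \<in> normal_pretangent_spaces p"
    using assms(1) F by (auto simp: X_def normal_pretangent_spaces_def pretangent_spaces_def)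
  define \<gamma> where "\<gamma> = zero_dist_rel r F `` {x}"
  have \<gamma>: "\<gamma> \<in> points X" "x \<in> \<gamma>"
    using F(1) by (simp_all add: \<gamma>_def X_def pretangent_space_def quotientI)
      (simp add: zero_dist_rel_def)
  have m: "(\<lambda>_. p) \<in> mark X"
    using F(1) by (auto simp: X_def pretangent_space_def zero_dist_rel_def)
  have "pdist X \<gamma> (mark X) = seq_dist r x (\<lambda>_. p)"
    using pdist_pretangent_space[OF r ss, of \<gamma> p x "mark X"] \<gamma> m
      pretangent_space_metric(1)[OF X] by (simp add: X_def)
  also have "\<dots> = s" using x by (simp add: seq_dist_def limI)
  finally have "ereal s \<le> rho_star X"
    unfolding rho_star_def using \<gamma>(1) by (intro SUP_upper2[of \<gamma>]) auto
  with X show ?thesis by blast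
qed

text \<open>
  The upper bound \<open>D\<close> keeps the quotients of the pairs in a compact interval. Since the scaling
  sequence may be any decreasing sequence of distances, passing to a subsequence costs nothing.
\<close>

lemma R_star_ge_if_comparable_pairs:
  fixes p :: "'a::metric_space"
  assumes "comparable_pairs (distance_set p) K D"
  shows "ereal K \<le> R_star (normal_pretangent_spaces p)"
proof -
  have ex: "\<exists>t w. 0 < t \<and> t < \<epsilon> \<and>
      (\<exists>x y. w = (x, y) \<and> t = dist y p \<and> K * t \<le> dist x p \<and> dist x p \<le> D * t)"
    if \<epsilon>: "\<epsilon> > 0" for \<epsilon>
  proof -
    obtain t e where te: "t \<in> distance_set p" "e \<in> distance_set p"
      "0 < t" "t < \<epsilon>" "K * t \<le> e" "e \<le> D * t"
      using assms \<epsilon> unfolding comparable_pairs_def by blast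
    then obtain x y where "t = dist y p" "e = dist x p"
      by (auto simp: distance_set_def)
    with te show ?thesis by (intro exI[of _ t] exI[of _ "(x, y)"]) auto
  qed
  obtain t :: "nat \<Rightarrow> real" and w :: "nat \<Rightarrow> 'a \<times> 'a" where
    t: "\<And>n. 0 < t n" and
    w: "\<And>n. \<exists>x y. w n = (x, y) \<and> t n = dist y p \<and> K * t n \<le> dist x p \<and> dist x p \<le> D * t n" and
    t_lim: "decseq t" "t \<longlonglongrightarrow> 0"
    using decreasing_null_choice[of "\<lambda>n t w.
      \<exists>x y. w = (x, y) \<and> t = dist y p \<and> K * t \<le> dist x p \<and> dist x p \<le> D * t", OF ex] by metis
  define x y where "x = fst \<circ> w" and "y = snd \<circ> w"
  have xy: "t n = dist (y n) p" "K * t n \<le> dist (x n) p" "dist (x n) p \<le> D * t n" for n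
    using w[of n] by (auto simp: x_def y_def)
  have "dist (x n) p / t n \<in> {K..D}" for n
    using xy(2,3)[of n] t[of n] by (auto simp: pos_le_divide_eq pos_divide_le_eq)
  then obtain s h where s: "s \<in> {K..D}" and h: "strict_mono h"
    and lim: "((\<lambda>n. dist (x n) p / t n) \<circ> h) \<longlonglongrightarrow> s"
    using compact_Icc[of K D, unfolded compact_def, rule_format, of "\<lambda>n. dist (x n) p / t n"]
    by blast
  have "normal_scaling p (t \<circ> h)"
    unfolding normal_scaling_def scaling_sequence_def eventually_decreasing_def
  proof (intro conjI allI)
    show "(t \<circ> h) \<longlonglongrightarrow> 0" using t_lim(2) h by (rule LIMSEQ_subseq_LIMSEQ)
    show "\<forall>\<^sub>F n in sequentially. (t \<circ> h) (Suc n) \<le> (t \<circ> h) n"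
      using t_lim(1) h by (intro always_eventually) (simp add: decseqD strict_mono_leD)
    show "\<exists>z. (\<lambda>n. dist (z n) p / (t \<circ> h) n) \<longlonglongrightarrow> 1"
      using t by (intro exI[of _ "y \<circ> h"])
        (simp add: xy(1)[symmetric] less_imp_neq[THEN not_sym])
  qed (use t in auto)
  from rho_star_ge[OF this, of "x \<circ> h"] lim
  obtain X where "X \<in> normal_pretangent_spaces p" "ereal s \<le> rho_star X"
    by (auto simp: o_def)
  then have "ereal s \<le> R_star (normal_pretangent_spaces p)"
    unfolding R_star_def by (rule SUP_upper2)
  moreover have "ereal K \<le> ereal s" using s by simp
  ultimately show ?thesis by (rule order_trans[rotated])
qed

lemma uniformly_bounded_iff_no_comparable_pairs:
  "uniformly_bounded_family (normal_pretangent_spaces p) \<longleftrightarrow>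
     (\<exists>K. \<forall>D. \<not> comparable_pairs (distance_set p) K D)"
proof
  assume "uniformly_bounded_family (normal_pretangent_spaces p)"
  then obtain c where c: "\<And>X. X \<in> normal_pretangent_spaces p \<Longrightarrow> space_diam X < ereal c"
    by (auto simp: uniformly_bounded_family_def)
  have "R_star (normal_pretangent_spaces p) \<le> ereal c"
    unfolding R_star_def
    by (rule SUP_least, rule order_trans[OF rho_star_le_space_diam less_imp_le[OF c]])
  then have "\<not> comparable_pairs (distance_set p) (c + 1) D" for D
    using R_star_ge_if_comparable_pairs[of p "c + 1" D] order_trans by fastforce
  then show "\<exists>K. \<forall>D. \<not> comparable_pairs (distance_set p) K D" by blast
next
  assume "\<exists>K. \<forall>D. \<not> comparable_pairs (distance_set p) K D"
  then obtain K where K: "\<And>D. \<not> comparable_pairs (distance_set p) K D" by blast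
  have "space_diam X < ereal (2 * \<bar>K\<bar> + 1)" if X: "X \<in> normal_pretangent_spaces p" for X
  proof -
    have "rho_star X \<le> ereal K"
      using comparable_pairs_if_less_rho_star[OF X, of K] K by (meson not_le)
    also have "\<dots> \<le> ereal \<bar>K\<bar>" by simp
    finally have "space_diam X \<le> ereal (2 * \<bar>K\<bar>)" by (rule space_diam_le_twice[OF X])
    also have "\<dots> < ereal (2 * \<bar>K\<bar> + 1)" by simp
    finally show ?thesis .
  qed
  then show "uniformly_bounded_family (normal_pretangent_spaces p)"
    unfolding uniformly_bounded_family_def by (intro exI[of _ "2 * \<bar>K\<bar> + 1"]) auto
qed

section \<open>Gaps\<close>

lemma interior_gap_disjoint_closure:
  fixes E :: "real set"
  shows "interior ({0..} - E) \<inter> closure E = {}"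
  using interior_subset[of "{0..} - E"] by (subst open_Int_closure_eq_empty) auto

lemma gap_componentI:
  fixes a b :: real
  assumes "0 \<le> a" "a < b" "{a<..<b} \<inter> E = {}" "a \<in> closure E" "b \<in> closure E"
  shows "{a<..<b} \<in> components (interior ({0..} - E))"
  unfolding in_components_maximal
proof (intro conjI allI impI)
  show "{a<..<b} \<noteq> {}" using assms(2) by simp
  show "{a<..<b} \<subseteq> interior ({0..} - E)"
    using assms(1,3) by (intro interior_maximal) auto
  show "connected {a<..<b}" by simp
  fix d assume d: "d \<noteq> {} \<and> {a<..<b} \<subseteq> d \<and> d \<subseteq> interior ({0..} - E) \<and> connected d"
  define c where "c = (a + b) / 2"
  have c: "a < c" "c < b" "c \<in> d" using d assms(2) by (auto simp: c_def subset_iff)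
  have nab: "a \<notin> d" "b \<notin> d"
    using d assms(4,5) interior_gap_disjoint_closure[of E] by blast+
  have conv: "z \<in> d" if "x \<in> d" "y \<in> d" "x \<le> z" "z \<le> y" for x y z
    using d that connectedD_interval by blast
  have "x \<in> {a<..<b}" if "x \<in> d" for x
    using conv[OF that c(3), of a] conv[OF c(3) that, of b] nab c by force
  with d show "d = {a<..<b}" by blast
qed

text \<open>
  If \<open>b\<close> had a positive distance from \<open>E\<close>, the interval could be prolonged beyond \<open>b\<close> without
  meeting \<open>E\<close>, against the maximality of a component.
\<close>

lemma gap_componentD:
  fixes a b :: real
  assumes "{a<..<b} \<in> components (interior ({0..} - E))"
  shows "0 \<le> a" "a < b" "{a<..<b} \<inter> E = {}" "b \<in> closure E"
proof -
  have C: "{a<..<b} \<noteq> {}" "{a<..<b} \<subseteq> interior ({0..} - E)"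
    and max: "\<And>d. d \<noteq> {} \<Longrightarrow> {a<..<b} \<subseteq> d \<Longrightarrow> d \<subseteq> interior ({0..} - E) \<Longrightarrow> connected d
      \<Longrightarrow> d = {a<..<b}"
    using assms unfolding in_components_maximal by blast+
  show ab: "a < b" using C(1) by simp
  have sub: "{a<..<b} \<subseteq> {0..} - E" using C(2) interior_subset by blast
  then show "{a<..<b} \<inter> E = {}" by blast
  show a0: "0 \<le> a"
  proof (rule ccontr)
    assume "\<not> 0 \<le> a"
    then have "(a + min b 0) / 2 \<in> {a<..<b}" "(a + min b 0) / 2 < 0" using ab by auto
    then show False using sub by (meson DiffD1 atLeast_iff not_le subsetD)
  qed
  show "b \<in> closure E"
  proof (rule ccontr)
    assume "b \<notin> closure E"
    then obtain e where e: "e > 0" "ball b e \<inter> E = {}"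
      by (auto simp: closure_approachable disjoint_iff dist_commute)
    have "{a<..<b + e} \<subseteq> {0..} - E"
    proof
      fix x assume x: "x \<in> {a<..<b + e}"
      show "x \<in> {0..} - E"
      proof (cases "x < b")
        case True
        then show ?thesis using x sub by auto
      next
        case False
        then have "x \<in> ball b e" using x by (auto simp: dist_real_def)
        then show ?thesis using e a0 x by auto
      qed
    qed
    then have "{a<..<b + e} \<subseteq> interior ({0..} - E)" by (intro interior_maximal) auto
    then have "{a<..<b + e} = {a<..<b}" using ab e(1) by (intro max) auto
    moreover have "b \<in> {a<..<b + e}" using ab e(1) by simp
    ultimately show False by simp
  qed
qed

lemma gap_seqsD:
  assumes "A \<in> gap_seqs E"
  shows "0 \<le> fst (A n)" "fst (A n) < snd (A n)" "{fst (A n)<..<snd (A n)} \<inter> E = {}"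
    "snd (A n) \<in> closure E" "eventually_decreasing (\<lambda>n. fst (A n))" "(\<lambda>n. fst (A n)) \<longlonglongrightarrow> 0"
    "(\<lambda>n. fst (A n) / snd (A n)) \<longlonglongrightarrow> 0"
proof -
  have comp: "{fst (A n)<..<snd (A n)} \<in> components (interior ({0..} - E))" for n
    using assms by (simp add: gap_seqs_def)
  note D = gap_componentD[OF comp]
  show "0 \<le> fst (A n)" "fst (A n) < snd (A n)" "{fst (A n)<..<snd (A n)} \<inter> E = {}"
    "snd (A n) \<in> closure E" using D by auto
  show "eventually_decreasing (\<lambda>n. fst (A n))" "(\<lambda>n. fst (A n)) \<longlonglongrightarrow> 0"
    using assms by (auto simp: gap_seqs_def)
  have "(\<lambda>n. 1 - (snd (A n) - fst (A n)) / snd (A n)) \<longlonglongrightarrow> 1 - 1"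
    using assms by (intro tendsto_diff tendsto_const) (simp add: gap_seqs_def)
  moreover have "1 - (snd (A n) - fst (A n)) / snd (A n) = fst (A n) / snd (A n)" for n
    using D(1,2)[of n] by (simp add: field_simps)
  ultimately show "(\<lambda>n. fst (A n) / snd (A n)) \<longlonglongrightarrow> 0" by simp
qed

lemma gap_start_pos:
  assumes "A \<in> gap_seqs E" "\<And>\<epsilon>. \<epsilon> > 0 \<Longrightarrow> \<exists>t\<in>E. 0 < t \<and> t < \<epsilon>"
  shows "0 < fst (A n)"
proof (rule ccontr)
  assume "\<not> 0 < fst (A n)"
  then have "fst (A n) = 0" using gap_seqsD(1)[OF assms(1), of n] by simp
  then show False
    using gap_seqsD(2,3)[OF assms(1), of n] assms(2)[of "snd (A n)"] by auto
qed

text \<open>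
  The gap belonging to \<open>\<tau> n\<close> is the one around \<open>K * \<tau> n\<close>. Without comparable pairs it reaches
  beyond \<open>D * \<tau> n\<close> for every \<open>D\<close> as soon as \<open>n\<close> is large, while it starts in \<open>[\<tau> n, K * \<tau> n]\<close>;
  its left end is the supremum of \<open>E\<close> below \<open>K * \<tau> n\<close> and hence inherits monotonicity from \<open>\<tau>\<close>.
\<close>

lemma gap_seq_along:
  fixes E :: "real set"
  assumes E: "E \<subseteq> {0..}" and \<tau>: "\<tau> \<in> decreasing_seqs E" and K: "K \<ge> 1"
    and none: "\<And>D. \<not> comparable_pairs E K D"
  obtains A where "A \<in> gap_seqs E" "\<And>n. 0 < fst (A n)"
    "\<forall>\<^sub>F n in sequentially. \<tau> n \<le> fst (A n) \<and> fst (A n) \<le> K * \<tau> n"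
proof -
  have \<tau>E: "\<tau> n \<in> E" for n using \<tau> by (simp add: decreasing_seqs_def)
  note \<tau>pos = decreasing_seqs_pos[OF \<tau> E]
  have \<tau>0: "\<tau> \<longlonglongrightarrow> 0" and \<tau>dec: "\<forall>\<^sub>F n in sequentially. \<tau> (Suc n) \<le> \<tau> n"
    using \<tau> by (auto simp: decreasing_seqs_def eventually_decreasing_def)
  have K\<tau>: "\<tau> n \<le> K * \<tau> n" for n using K \<tau>pos[of n] by simp
  define lo where "lo n = E \<inter> {..K * \<tau> n}" for n
  define hi where "hi n = E \<inter> {K * \<tau> n..}" for n
  define a where "a n = Sup (lo n)" for n
  define b where "b n = Inf (hi n)" for n
  have lo: "\<tau> n \<in> lo n" "bdd_above (lo n)" for n
    using \<tau>E K\<tau> by (auto simp: lo_def)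
  have hib: "bdd_below (hi n)" for n by (auto simp: hi_def)
  have a1: "\<tau> n \<le> a n" for n unfolding a_def using lo by (intro cSup_upper)
  have a2: "a n \<le> K * \<tau> n" for n
    unfolding a_def using lo(1)[of n] by (intro cSup_least) (auto simp: lo_def)
  have acl: "a n \<in> closure E" for n
    using closure_contains_Sup[of "lo n"] lo[of n] closure_mono[of "lo n" E]
    by (auto simp: a_def lo_def)
  have hi: "\<forall>\<^sub>F n in sequentially. hi n \<noteq> {}"
  proof -
    have "(\<lambda>n. K * \<tau> n) \<longlonglongrightarrow> K * 0" using \<tau>0 by (intro tendsto_intros)
    then have "\<forall>\<^sub>F n in sequentially. K * \<tau> n < \<tau> 0"
      using order_tendstoD(2)[of _ "0::real" _ "\<tau> 0"] \<tau>pos[of 0] by simp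
    then show ?thesis
    proof eventually_elim
      case (elim n)
      then have "\<tau> 0 \<in> hi n" using \<tau>E by (simp add: hi_def)
      then show "hi n \<noteq> {}" by blast
    qed
  qed
  have blarge: "\<forall>\<^sub>F n in sequentially. D * \<tau> n \<le> b n" for D
  proof -
    obtain \<epsilon> where \<epsilon>: "\<epsilon> > 0" and
      no: "\<And>t e. t \<in> E \<Longrightarrow> e \<in> E \<Longrightarrow> 0 < t \<Longrightarrow> t < \<epsilon> \<Longrightarrow> K * t \<le> e \<Longrightarrow> D * t < e"
      using none[of D] unfolding comparable_pairs_def by (meson not_le)
    show ?thesis using order_tendstoD(2)[OF \<tau>0 \<epsilon>] hi
    proof eventually_elim
      case (elim n)
      show "D * \<tau> n \<le> b n" unfolding b_def
        using no[OF \<tau>E _ \<tau>pos elim(1)] elim(2)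
        by (intro cInf_greatest) (auto simp: hi_def less_imp_le)
    qed
  qed
  have comp: "\<forall>\<^sub>F n in sequentially. {a n<..<b n} \<in> components (interior ({0..} - E)) \<and> a n < b n"
    using blarge[of "K + 1"] hi
  proof eventually_elim
    case (elim n)
    have ab: "a n < b n" using a2[of n] elim(1) \<tau>pos[of n] by (simp add: distrib_right)
    have "x \<le> a n \<or> b n \<le> x" if "x \<in> E" for x
    proof (cases "x \<le> K * \<tau> n")
      case True
      then have "x \<le> a n" unfolding a_def using that lo by (intro cSup_upper) (auto simp: lo_def)
      then show ?thesis ..
    next
      case False
      then have "b n \<le> x" unfolding b_def using that hib by (intro cInf_lower) (auto simp: hi_def)
      then show ?thesis ..
    qed
    then have dis: "{a n<..<b n} \<inter> E = {}" by force
    have bcl: "b n \<in> closure E"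
      using closure_contains_Inf[OF elim(2) hib] closure_mono[of "hi n" E]
      by (auto simp: b_def hi_def)
    show ?case
      using gap_componentI[OF _ ab dis acl bcl] a1[of n] \<tau>pos[of n] ab by simp
  qed
  then obtain N where N: "\<And>n. n \<ge> N \<Longrightarrow> {a n<..<b n} \<in> components (interior ({0..} - E))"
    "\<And>n. n \<ge> N \<Longrightarrow> a n < b n"
    by (auto simp: eventually_sequentially)
  \<comment> \<open>Finitely many indices may have no gap; there the gap with index \<open>N\<close> is used.\<close>
  define A where "A n = (a (max N n), b (max N n))" for n
  have evA: "\<forall>\<^sub>F n in sequentially. A n = (a n, b n)"
    using eventually_ge_at_top[of N] by eventually_elim (simp add: A_def max_absorb2)
  have a0: "a \<longlonglongrightarrow> 0"
  proof (rule tendsto_sandwich[of "\<lambda>_. 0" _ _ "\<lambda>n. K * \<tau> n"])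
    show "(\<lambda>n. K * \<tau> n) \<longlonglongrightarrow> 0" using tendsto_mult_left[OF \<tau>0, of K] by simp
    show "\<forall>\<^sub>F n in sequentially. 0 \<le> a n" using a1 \<tau>pos by (meson always_eventually less_imp_le order_trans)
  qed (use a2 in auto)
  have ratio: "(\<lambda>n. a n / b n) \<longlonglongrightarrow> 0"
  proof (rule order_tendstoI)
    fix y :: real assume y: "y < 0"
    show "\<forall>\<^sub>F n in sequentially. y < a n / b n"
      using eventually_ge_at_top[of N]
    proof eventually_elim
      case (elim n)
      have "0 < a n" "a n < b n" using a1[of n] \<tau>pos[of n] N(2)[OF elim] by auto
      then have "0 < a n / b n" by simp
      then show ?case using y by simp
    qed
  next
    fix y :: real assume y: "0 < y"
    show "\<forall>\<^sub>F n in sequentially. a n / b n < y"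
      using blarge[of "2 * K / y"] eventually_ge_at_top[of N]
    proof eventually_elim
      case (elim n)
      have b: "0 < b n" using a1[of n] \<tau>pos[of n] N(2)[OF elim(2)] by auto
      have "K * \<tau> n < 2 * K * \<tau> n" using K \<tau>pos[of n] by simp
      also have "\<dots> \<le> y * b n" using elim(1) y by (simp add: field_simps)
      finally show ?case using a2[of n] b by (simp add: pos_divide_less_eq)
    qed
  qed
  have "A \<in> gap_seqs E"
    unfolding gap_seqs_def mem_Collect_eq
  proof (intro conjI allI)
    show "{fst (A n)<..<snd (A n)} \<in> components (interior ({0..} - E))" for n
      using N(1)[of "max N n"] by (simp add: A_def)
    have "\<forall>\<^sub>F n in sequentially. A (Suc n) = (a (Suc n), b (Suc n))"
      using evA by (simp add: eventually_sequentially_Suc[of "\<lambda>n. A n = (a n, b n)"])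
    with evA \<tau>dec show "eventually_decreasing (\<lambda>n. fst (A n))"
      unfolding eventually_decreasing_def
    proof eventually_elim
      case (elim n)
      have "K * \<tau> (Suc n) \<le> K * \<tau> n" using elim(2) K by simp
      then have "lo (Suc n) \<subseteq> lo n" by (auto simp: lo_def)
      then have "a (Suc n) \<le> a n" unfolding a_def using lo by (intro cSup_subset_mono) auto
      then show ?case using elim by simp
    qed
    show "(\<lambda>n. fst (A n)) \<longlonglongrightarrow> 0"
      by (rule Lim_transform_eventually[OF a0]) (use evA in eventually_elim, simp)
    have "(\<lambda>n. 1 - a n / b n) \<longlonglongrightarrow> 1 - 0" using ratio by (intro tendsto_intros)
    then have "(\<lambda>n. 1 - a n / b n) \<longlonglongrightarrow> 1" by simp
    then show "(\<lambda>n. (snd (A n) - fst (A n)) / snd (A n)) \<longlonglongrightarrow> 1"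
    proof (rule Lim_transform_eventually)
      show "\<forall>\<^sub>F n in sequentially. 1 - a n / b n = (snd (A n) - fst (A n)) / snd (A n)"
        using evA eventually_ge_at_top[of N]
      proof eventually_elim
        case (elim n)
        have "b n \<noteq> 0" using a1[of n] \<tau>pos[of n] N(2)[OF elim(2)] by auto
        then show ?case using elim(1) by (simp add: diff_divide_distrib)
      qed
    qed
  qed
  moreover have "0 < fst (A n)" for n
    using a1[of "max N n"] \<tau>pos[of "max N n"] by (simp add: A_def)
  moreover have "\<forall>\<^sub>F n in sequentially. \<tau> n \<le> fst (A n) \<and> fst (A n) \<le> K * \<tau> n"
    using evA by eventually_elim (use a1 a2 in simp)
  ultimately show ?thesis by (rule that)
qed

section \<open>Complete strong porosity\<close>

lemma asymp_comparableI:
  fixes a g :: "nat \<Rightarrow> real"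
  assumes pos: "\<And>n. 0 < a n" "\<And>n. 0 < g n"
    and ev: "\<forall>\<^sub>F n in sequentially. a n \<le> g n \<and> g n \<le> K * a n"
  shows "asymp_comparable a g"
proof -
  have "Bseq (\<lambda>n. g n / a n)"
    by (rule BfunI[of _ K], use ev in eventually_elim)
       (use pos in \<open>simp add: less_imp_le pos_divide_le_eq\<close>)
  then obtain C where C: "C > 0" "\<And>n. norm (g n / a n) \<le> C" by (auto elim: BseqE)
  have "Bseq (\<lambda>n. a n / g n)"
    by (rule BfunI[of _ 1], use ev in eventually_elim)
       (use pos in \<open>simp add: less_imp_le pos_divide_le_eq\<close>)
  then obtain c where c: "c > 0" "\<And>n. norm (a n / g n) \<le> c" by (auto elim: BseqE)
  have "1 / (c + 1) * a n < g n \<and> g n < (C + 1) * a n" for n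
  proof
    have "a n \<le> c * g n"
      using c(2)[of n] pos[of n] by (simp add: pos_divide_le_eq abs_of_pos)
    then have "a n < (c + 1) * g n" using pos(2)[of n] by (simp add: distrib_right)
    then show "1 / (c + 1) * a n < g n" using c(1) by (simp add: field_simps)
    have "g n \<le> C * a n"
      using C(2)[of n] pos[of n] by (simp add: pos_divide_le_eq abs_of_pos)
    then show "g n < (C + 1) * a n" using pos(1)[of n] by (simp add: distrib_right)
  qed
  then show ?thesis
    unfolding asymp_comparable_def using c(1) C(1)
    by (intro exI[of _ "1 / (c + 1)"] exI[of _ "C + 1"] conjI) auto
qed

lemma CSP_if_no_comparable_pairs:
  assumes E: "E \<subseteq> {0..}" and none: "\<And>D. \<not> comparable_pairs E K D"
  shows "E \<in> CSP"
proof -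
  have none': "\<not> comparable_pairs E (max 1 K) D" for D
    using none comparable_pairs_mono[of E "max 1 K" D K D] by auto
  have "strongly_porous_along \<tau> E" if \<tau>: "\<tau> \<in> decreasing_seqs E" for \<tau>
  proof -
    obtain A where A: "A \<in> gap_seqs E" "\<And>n. 0 < fst (A n)"
      "\<forall>\<^sub>F n in sequentially. \<tau> n \<le> fst (A n) \<and> fst (A n) \<le> max 1 K * \<tau> n"
      using gap_seq_along[OF E \<tau> _ none'] by auto
    have "asymp_comparable \<tau> (\<lambda>n. fst (A n))"
      using decreasing_seqs_pos[OF \<tau> E] A(2,3) by (rule asymp_comparableI)
    with A(1) show ?thesis unfolding strongly_porous_along_def by blast
  qed
  with E show ?thesis by (simp add: CSP_def)
qed

text \<open>
  The sequence \<open>\<tau>\<close> built here uses comparable pairs for every \<open>k\<close> infinitely often. Strong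
  porosity along \<open>\<tau>\<close> comes with one constant \<open>c2\<close>; for a fixed \<open>k \<ge> c2\<close> the infinitely many
  gaps belonging to \<open>k\<close> are stopped by the larger members of the pairs and so have bounded
  quotients of their end points.
\<close>

lemma no_comparable_pairs_if_CSP:
  assumes "E \<in> CSP"
  shows "\<exists>K. \<forall>D. \<not> comparable_pairs E K D"
proof (rule ccontr)
  assume "\<not> ?thesis"
  then have "\<forall>k::nat. \<exists>D. comparable_pairs E (real k) D" by blast
  then obtain D where D: "\<And>k::nat. comparable_pairs E (real k) (D k)" by metis
  \<comment> \<open>The first component of the inverse Cantor pairing takes every value infinitely often.\<close>
  define \<kappa> where "\<kappa> n = fst (prod_decode n)" for n
  have ex: "\<exists>t e. 0 < t \<and> t < \<epsilon> \<and>
      (t \<in> E \<and> e \<in> E \<and> real (\<kappa> n) * t \<le> e \<and> e \<le> D (\<kappa> n) * t)" if "\<epsilon> > 0" for n \<epsilon>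
    using D[of "\<kappa> n"] that unfolding comparable_pairs_def by blast
  obtain \<tau> e where \<tau>: "\<And>n. 0 < \<tau> n" and
    e: "\<And>n. \<tau> n \<in> E \<and> e n \<in> E \<and> real (\<kappa> n) * \<tau> n \<le> e n \<and> e n \<le> D (\<kappa> n) * \<tau> n" and
    \<tau>_lim: "decseq \<tau>" "\<tau> \<longlonglongrightarrow> 0"
    using decreasing_null_choice[of "\<lambda>n t e.
      t \<in> E \<and> e \<in> E \<and> real (\<kappa> n) * t \<le> e \<and> e \<le> D (\<kappa> n) * t", OF ex] by metis
  have "\<tau> \<in> decreasing_seqs E" using \<tau> e \<tau>_lim by (intro decreasing_seqsI) auto
  then obtain A where A: "A \<in> gap_seqs E" "asymp_comparable \<tau> (\<lambda>n. fst (A n))"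
    using assms by (auto simp: CSP_def strongly_porous_along_def)
  obtain c1 c2 where c: "c1 > 0" "c2 > 0"
    "\<And>n. c1 * \<tau> n < fst (A n)" "\<And>n. fst (A n) < c2 * \<tau> n"
    using A(2) unfolding asymp_comparable_def by blast
  obtain k :: nat where k: "c2 \<le> real k" using real_arch_simple by blast
  have bound: "fst (A n) < e n \<and> snd (A n) \<le> e n" if "\<kappa> n = k" for n
  proof -
    have "fst (A n) < c2 * \<tau> n" by (rule c)
    also have "\<dots> \<le> real k * \<tau> n" using k \<tau>[of n] by (intro mult_right_mono) auto
    also have "\<dots> \<le> e n" using e[of n] that by simp
    finally have "fst (A n) < e n" .
    then show ?thesis using gap_seqsD(3)[OF A(1), of n] e[of n] by force
  qed
  define n0 where "n0 = prod_encode (k, 0)"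
  have n0: "\<kappa> n0 = k" by (simp add: n0_def \<kappa>_def)
  have Dk: "D k > 0"
  proof -
    have "0 < fst (A n0)" using c(1) c(3)[of n0] \<tau>[of n0] by (meson less_trans mult_pos_pos)
    then have "0 < D k * \<tau> n0" using bound[OF n0] e[of n0] n0 by simp
    then show ?thesis using \<tau>[of n0] by (simp add: zero_less_mult_iff)
  qed
  have "\<forall>\<^sub>F n in sequentially. fst (A n) / snd (A n) < c1 / D k"
    using order_tendstoD(2)[OF gap_seqsD(7)[OF A(1)]] c(1) Dk by simp
  then obtain N where N: "\<And>n. n \<ge> N \<Longrightarrow> fst (A n) / snd (A n) < c1 / D k"
    by (auto simp: eventually_sequentially)
  define n where "n = prod_encode (k, N)"
  have n: "\<kappa> n = k" "n \<ge> N" by (auto simp: n_def \<kappa>_def le_prod_encode_2)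
  have pos: "0 < snd (A n)" using gap_seqsD(1,2)[OF A(1), of n] by linarith
  have "snd (A n) \<le> D k * \<tau> n" using bound[OF n(1)] e[of n] n(1) by simp
  then have "c1 * snd (A n) \<le> D k * (c1 * \<tau> n)"
    using c(1) by (simp add: mult.left_commute)
  also have "\<dots> < D k * fst (A n)" using c(3)[of n] Dk by simp
  finally have "c1 / D k < fst (A n) / snd (A n)" using pos Dk by (simp add: field_simps)
  then show False using N[OF n(2)] by simp
qed

section \<open>Universal gap sequences\<close>

text \<open>
  Write \<open>(l n, m n)\<close> for \<open>L n\<close>. For a comparable pair \<open>t, e\<close> close to \<open>0\<close> let \<open>i\<close> be the last index with \<open>t \<le> l i\<close>. Then \<open>t\<close> lies above
  the gap with index \<open>i + 1\<close>, and \<open>e\<close> cannot lie above the gap with index \<open>i\<close>, because that gap is too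
  long for \<open>e / t \<le> D\<close>.
\<close>

lemma gap_M_ge_if_comparable_pairs:
  assumes L: "L \<in> gap_seqs E" and pos: "\<And>n. 0 < fst (L n)" and CP: "comparable_pairs E K D"
  shows "ereal K \<le> gap_M L"
proof (rule ccontr)
  assume "\<not> ?thesis"
  then have "limsup (\<lambda>n. ereal (fst (L n) / snd (L (Suc n)))) < ereal K"
    by (simp add: gap_M_def)
  then have 1: "\<forall>\<^sub>F n in sequentially. fst (L n) / snd (L (Suc n)) < K"
    by (auto dest: Limsup_lessD)
  have spos: "0 < snd (L n)" for n using gap_seqsD(2)[OF L, of n] pos[of n] by linarith
  have 2: "\<forall>\<^sub>F n in sequentially. fst (L n) / snd (L n) < 1 / (\<bar>D\<bar> + 1)"
    by (rule order_tendstoD(2)[OF gap_seqsD(7)[OF L]]) simp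
  obtain N where N: "\<And>n. n \<ge> N \<Longrightarrow> fst (L n) / snd (L (Suc n)) < K"
    "\<And>n. n \<ge> N \<Longrightarrow> fst (L n) / snd (L n) < 1 / (\<bar>D\<bar> + 1)"
    using eventually_conj[OF 1 2] by (auto simp: eventually_sequentially)
  obtain t e where te: "t \<in> E" "e \<in> E" "0 < t" "t < fst (L N)" "K * t \<le> e" "e \<le> D * t"
    using CP pos[of N] unfolding comparable_pairs_def by blast
  have "\<forall>\<^sub>F n in sequentially. fst (L n) < t"
    by (rule order_tendstoD(2)[OF gap_seqsD(6)[OF L] te(3)])
  then obtain M where M: "\<And>n. n \<ge> M \<Longrightarrow> fst (L n) < t" by (auto simp: eventually_sequentially)
  define i where "i = (GREATEST i. t \<le> fst (L i))"
  have bd: "\<forall>j. t \<le> fst (L j) \<longrightarrow> j \<le> M" using M by (meson nat_le_linear not_le)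
  have i1: "t \<le> fst (L i)" unfolding i_def
    by (rule GreatestI_nat[where k = N and b = M]) (use te(4) bd in auto)
  have i2: "N \<le> i" unfolding i_def
    by (rule Greatest_le_nat[where b = M]) (use te(4) bd in auto)
  have "\<not> t \<le> fst (L (Suc i))"
  proof
    assume "t \<le> fst (L (Suc i))"
    then have "Suc i \<le> i" unfolding i_def
      by (intro Greatest_le_nat[where b = M]) (use bd in \<open>auto simp: i_def\<close>)
    then show False by simp
  qed
  then have mt: "snd (L (Suc i)) \<le> t" using gap_seqsD(3)[OF L, of "Suc i"] te(1) by force
  show False
  proof (cases "e \<le> fst (L i)")
    case True
    have "fst (L i) < K * snd (L (Suc i))"
      using N(1)[OF i2] spos[of "Suc i"] by (simp add: pos_divide_less_eq)
    moreover from this have "0 < K * snd (L (Suc i))" using pos[of i] by linarith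
    then have "0 < K" using spos[of "Suc i"] by (simp add: zero_less_mult_iff)
    then have "K * snd (L (Suc i)) \<le> K * t" using mt by simp
    ultimately show False using True te(5) by linarith
  next
    case False
    then have "snd (L i) \<le> e" using gap_seqsD(3)[OF L, of i] te(2) by force
    also have "\<dots> \<le> D * t" by (rule te)
    also have "\<dots> \<le> (\<bar>D\<bar> + 1) * t" using te(3) by (intro mult_right_mono) auto
    also have "\<dots> \<le> (\<bar>D\<bar> + 1) * fst (L i)" using i1 by (intro mult_left_mono) auto
    finally show False using N(2)[OF i2] spos[of i] by (simp add: field_simps)
  qed
qed

text \<open>
  Suppose that \<open>K < l i / m (i + 1)\<close> for infinitely many \<open>i\<close>, and choose points \<open>\<tau> n \<in> E\<close> just
  above such \<open>m (i + 1)\<close>. In the absence of comparable pairs, \<open>gap_seq_along\<close> gives long gaps that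
  start in \<open>[\<tau> n, K * \<tau> n]\<close>, strictly between \<open>l (i + 1)\<close> and \<open>l i\<close>. As \<open>l\<close> is eventually
  decreasing, such a start is not a value of \<open>l\<close>, contrary to universality.
\<close>

lemma comparable_pairs_if_less_gap_M:
  assumes E: "E \<subseteq> {0..}" and U: "universal_gap_seq E L" and pos: "\<And>n. 0 < fst (L n)"
    and K: "1 \<le> K" "ereal K < gap_M L"
  shows "\<exists>D. comparable_pairs E K D"
proof (rule ccontr)
  assume none: "\<not> ?thesis"
  have L: "L \<in> gap_seqs E" using U by (simp add: universal_gap_seq_def)
  have spos: "0 < snd (L n)" for n using gap_seqsD(2)[OF L, of n] pos[of n] by linarith
  obtain K' where K': "K < K'" "ereal K' < gap_M L"
    using ereal_dense2[OF K(2)] by auto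
  obtain N where N: "\<And>n. n \<ge> N \<Longrightarrow> fst (L (Suc n)) \<le> fst (L n)"
    using gap_seqsD(5)[OF L] by (auto simp: eventually_decreasing_def eventually_sequentially)
  have anti: "fst (L j) \<le> fst (L i)" if "N \<le> i" "i \<le> j" for i j
    using that(2)
  proof (induction j rule: dec_induct)
    case (step j)
    then show ?case using N[of j] that(1) by linarith
  qed simp
  have ex: "\<exists>t i. 0 < t \<and> t < \<epsilon> \<and> (t \<in> E \<and> N \<le> i \<and> fst (L (Suc i)) < t \<and> K * t < fst (L i))"
    if \<epsilon>: "\<epsilon> > 0" for \<epsilon>
  proof -
    have "\<forall>\<^sub>F n in sequentially. fst (L n) < \<epsilon> \<and> N \<le> n"
      using order_tendstoD(2)[OF gap_seqsD(6)[OF L] \<epsilon>] eventually_ge_at_top[of N]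
      by (rule eventually_conj)
    then obtain M where M: "\<And>n. n \<ge> M \<Longrightarrow> fst (L n) < \<epsilon> \<and> N \<le> n"
      by (auto simp: eventually_sequentially)
    have "\<exists>i\<ge>M. K' < fst (L i) / snd (L (Suc i))"
    proof (rule ccontr)
      assume "\<not> ?thesis"
      then have "\<forall>\<^sub>F i in sequentially. ereal (fst (L i) / snd (L (Suc i))) \<le> ereal K'"
        by (auto simp: eventually_sequentially not_less)
      then have "gap_M L \<le> ereal K'" unfolding gap_M_def by (rule Limsup_bounded)
      then show False using K'(2) by simp
    qed
    then obtain i where i: "i \<ge> M" "K' < fst (L i) / snd (L (Suc i))" by blast
    define m where "m = snd (L (Suc i))"
    have m: "0 < m" "K' * m < fst (L i)"
      using i(2) spos[of "Suc i"] by (auto simp: m_def pos_less_divide_eq)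
    \<comment> \<open>Any \<open>t\<close> below \<open>m * K' / K\<close> satisfies \<open>K * t < l i\<close>, and \<open>m\<close> is a limit of points of \<open>E\<close>.\<close>
    have "m < m * K' / K" using m(1) K(1) K'(1) by (simp add: field_simps)
    moreover have "\<And>d. d > 0 \<Longrightarrow> \<exists>t\<in>E. dist t m < d"
      using gap_seqsD(4)[OF L, of "Suc i"] by (simp add: m_def closure_approachable)
    moreover have "fst (L (Suc i)) < m" using gap_seqsD(2)[OF L] by (simp add: m_def)
    ultimately obtain t where t: "t \<in> E"
      "dist t m < min (m * K' / K - m) (m - fst (L (Suc i)))"
      by (metis diff_gt_0_iff_gt min_less_iff_conj)
    then have t1: "t < m * K' / K" "fst (L (Suc i)) < t"
      by (auto simp: dist_real_def)
    have "K * t < K' * m" using t1(1) K(1) by (simp add: pos_less_divide_eq mult.commute)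
    then have "K * t < fst (L i)" using m(2) by linarith
    moreover have "0 < t" using pos[of "Suc i"] t1(2) by linarith
    moreover from this have "t \<le> K * t" using K(1) by simp
    moreover have "t < \<epsilon>"
      using calculation M[OF i(1)] by linarith
    ultimately show ?thesis using M[OF i(1)] t(1) t1(2) by blast
  qed
  obtain \<tau> and i :: "nat \<Rightarrow> nat" where \<tau>: "\<And>n. 0 < \<tau> n" and
    i: "\<And>n. \<tau> n \<in> E \<and> N \<le> i n \<and> fst (L (Suc (i n))) < \<tau> n \<and> K * \<tau> n < fst (L (i n))" and
    \<tau>_lim: "decseq \<tau>" "\<tau> \<longlonglongrightarrow> 0"
    using decreasing_null_choice[of "\<lambda>n t i.
      t \<in> E \<and> N \<le> i \<and> fst (L (Suc i)) < t \<and> K * t < fst (L i)", OF ex] by metis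
  have "\<tau> \<in> decreasing_seqs E" using \<tau> i \<tau>_lim by (intro decreasing_seqsI) auto
  then obtain A where A: "A \<in> gap_seqs E"
    "\<forall>\<^sub>F n in sequentially. \<tau> n \<le> fst (A n) \<and> fst (A n) \<le> K * \<tau> n"
    using gap_seq_along[OF E _ K(1)] none by blast
  obtain N' f where f: "\<And>n. n \<ge> N' \<Longrightarrow> fst (A n) = fst (L (f n))"
    using U A(1) unfolding universal_gap_seq_def gap_preceq_def by blast
  define \<delta> where "\<delta> = Min ((\<lambda>j. fst (L j)) ` {..N})"
  have \<delta>: "0 < \<delta>" "\<And>j. j \<le> N \<Longrightarrow> \<delta> \<le> fst (L j)"
    using pos by (auto simp: \<delta>_def)
  have "\<forall>\<^sub>F n in sequentially. (\<tau> n \<le> fst (A n) \<and> fst (A n) \<le> K * \<tau> n) \<and> fst (A n) < \<delta> \<and> n \<ge> N'"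
    using A(2) order_tendstoD(2)[OF gap_seqsD(6)[OF A(1)] \<delta>(1)] eventually_ge_at_top[of N']
    by (simp add: eventually_conj_iff)
  then obtain n where n: "\<tau> n \<le> fst (A n)" "fst (A n) \<le> K * \<tau> n" "fst (A n) < \<delta>" "n \<ge> N'"
    by (auto dest: eventually_happens)
  then have fn: "fst (L (Suc (i n))) < fst (L (f n))" "fst (L (f n)) < fst (L (i n))"
    "fst (L (f n)) < \<delta>"
    using i[of n] f[OF n(4)] by linarith+
  have "N \<le> f n" using \<delta>(2)[of "f n"] fn(3) by linarith
  then have "f n > i n" using anti[of "f n" "i n"] fn(2) by linarith
  then show False using anti[of "Suc (i n)" "f n"] i[of n] fn(1) by auto
qed

lemma ereal_le_by_reals:
  fixes x y :: ereal
  assumes "\<And>K::real. ereal K < x \<Longrightarrow> ereal K \<le> y"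
  shows "x \<le> y"
  using assms ereal_dense2[of y x] by (meson not_le)

lemma R_star_eq_gap_M:
  fixes p :: "'a::metric_space"
  assumes lim: "p islimpt (UNIV :: 'a set)" and U: "universal_gap_seq (distance_set p) L"
  shows "R_star (normal_pretangent_spaces p) = gap_M L"
proof (rule antisym)
  have L: "L \<in> gap_seqs (distance_set p)" using U by (simp add: universal_gap_seq_def)
  have pos: "0 < fst (L n)" for n by (rule gap_start_pos[OF L small_distances[OF lim]])
  show "R_star (normal_pretangent_spaces p) \<le> gap_M L"
  proof (rule ereal_le_by_reals)
    fix K :: real assume "ereal K < R_star (normal_pretangent_spaces p)"
    then obtain D where "comparable_pairs (distance_set p) K D"
      using comparable_pairs_if_less_R_star by blast
    then show "ereal K \<le> gap_M L" by (rule gap_M_ge_if_comparable_pairs[OF L pos])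
  qed
  show "gap_M L \<le> R_star (normal_pretangent_spaces p)"
  proof (rule ereal_le_by_reals)
    fix K :: real assume K: "ereal K < gap_M L"
    have "\<exists>D. comparable_pairs (distance_set p) K D"
    proof (cases "1 \<le> K")
      case True
      then show ?thesis
        by (rule comparable_pairs_if_less_gap_M[OF distance_set_nonneg U pos _ K])
    next
      case False
      have "comparable_pairs (distance_set p) 1 1"
        using small_distances[OF lim] unfolding comparable_pairs_def by fastforce
      then show ?thesis using False comparable_pairs_mono[of _ 1 1 K 1] by auto
    qed
    then show "ereal K \<le> R_star (normal_pretangent_spaces p)"
      using R_star_ge_if_comparable_pairs by blast
  qed
qed

theorem theorem3p11:
  fixes p :: "'a::metric_space"
  shows "(uniformly_bounded_family (normal_pretangent_spaces p) \<longleftrightarrow> distance_set p \<in> CSP) \<and>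
    (uniformly_bounded_family (normal_pretangent_spaces p) \<and> p islimpt (UNIV :: 'a set) \<longrightarrow>
      (\<forall>L. universal_gap_seq (distance_set p) L \<longrightarrow>
        R_star (normal_pretangent_spaces p) = gap_M L))"
  unfolding uniformly_bounded_iff_no_comparable_pairs
  using CSP_if_no_comparable_pairs[OF distance_set_nonneg] no_comparable_pairs_if_CSP
    R_star_eq_gap_M by blast

end
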